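(* The Hilbert space $L^{2,\mathrm{e}}(\mathbb{T}^3)$ decomposes orthogonally as $$L^{2,\mathrm{e}}(\mathbb{T}^3)=L^{2,\mathrm{e,s}}(\mathbb{T}^3)\oplus L^{2,\mathrm{e,a_{12}}}(\mathbb{T}^3)\oplus L^{2,\mathrm{e,mix}}(\mathbb{T}^3),$$ where $$L^{2,\mathrm{e,s}}(\mathbb{T}^3)=\{f\in L^{2,\mathrm{e}}(\mathbb{T}^3): f \text{ is symmetric under all permutations of } (p_1,p_2,p_3)\},$$ $$L^{2,\mathrm{e,a_{12}}}(\mathbb{T}^3)=\{f\in L^{2,\mathrm{e}}(\mathbb{T}^3): f(p_1,p_2,p_3)=-f(p_2,p_1,p_3)\},$$ and $L^{2,\mathrm{e,mix}}(\mathbb{T}^3)$ is the set of all $f\in L^{2,\mathrm{e}}(\mathbb{T}^3)$ such that $f(p_1,p_2,p_3)=f(p_2,p_1,p_3)$ and $f=f_1+f_2$ for some $f_1,f_2\in L^{2,\mathrm{e}}(\mathbb{T}^3)$ with $f_1(p_1,p_2,p_3)=-f_1(p_3,p_2,p_1)$ and $f_2(p_1,p_2,p_3)=-f_2(p_1,p_3,p_2)$.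
   Context: $\mathbb{T}^3=(\mathbb{R}/2\pi\mathbb{Z})^3$ with Lebesgue measure; $L^{2,\mathrm{e}}(\mathbb{T}^3)$ is the Hilbert space of even functions $f\in L^2(\mathbb{T}^3)$, i.e. $f(-p)=f(p)$. Identities between functions are understood almost everywhere. *)

theory Defs
  imports "HOL-Analysis.Analysis" "HOL-Library.Real_Mod"
begin

section \<open>The three-dimensional torus\<close>

quotient_type circle = real / "\<lambda>x y. [x = y] (rmod (2 * pi))"
  morphisms rep_circle to_circle
  by (rule equivpI) (auto simp: reflp_def symp_def transp_def rcong_def)

instantiation circle :: uminus
begin

lift_definition uminus_circle :: "circle \<Rightarrow> circle" is "uminus"
  by (rule rcong_uminus)

instance ..

end

type_synonym torus3 = "circle ^ 3"

definition to_torus :: "real ^ 3 \<Rightarrow> torus3" where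
  "to_torus x = (\<chi> i. to_circle (x $ i))"

text \<open>A subset of the torus is Lebesgue measurable iff its periodic lift to \<open>real ^ 3\<close> is.
  Lebesgue measure on the torus is the push-forward of Lebesgue measure on the fundamental cube,
  so its total mass is \<open>(2 * pi) ^ 3\<close>.\<close>

definition torus_sets :: "torus3 set set" where
  "torus_sets = {A. to_torus -` A \<in> sets lebesgue}"

definition fundamental_cube :: "(real ^ 3) set" where
  "fundamental_cube = {x. \<forall>i. x $ i \<in> {0..<2 * pi}}"

definition torus_measure :: "torus3 measure" where
  "torus_measure =
     distr (restrict_space lebesgue fundamental_cube) (sigma UNIV torus_sets) to_torus"

lemma sigma_algebra_torus_sets: "sigma_algebra UNIV torus_sets"
proof -
  have "(\<Union>i::nat. A i) \<in> torus_sets" if "range A \<subseteq> torus_sets" for A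
  proof -
    have "to_torus -` A i \<in> sets lebesgue" for i
      using that by (auto simp: torus_sets_def)
    then show ?thesis
      by (simp add: torus_sets_def vimage_UN sets.countable_UN)
  qed
  moreover have "UNIV - A \<in> torus_sets" if "A \<in> torus_sets" for A
  proof -
    have "to_torus -` (UNIV - A) = space lebesgue - to_torus -` A" by auto
    also have "\<dots> \<in> sets lebesgue"
      using that unfolding torus_sets_def by (intro sets.compl_sets) simp
    finally show ?thesis by (simp add: torus_sets_def)
  qed
  moreover have "{} \<in> torus_sets" by (simp add: torus_sets_def)
  ultimately show ?thesis by (simp add: sigma_algebra_iff2)
qed

lemma space_torus_measure [simp]: "space torus_measure = UNIV"
  by (simp add: torus_measure_def)

lemma sets_torus_measure: "sets torus_measure = torus_sets"
  by (simp add: torus_measure_def sigma_algebra.sets_measure_of_eq[OF sigma_algebra_torus_sets])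

lemma measurable_to_torus:
  "to_torus \<in> restrict_space lebesgue fundamental_cube \<rightarrow>\<^sub>M sigma UNIV torus_sets"
proof (rule measurable_restrict_space1, rule measurableI)
  fix A assume "A \<in> sets (sigma UNIV torus_sets)"
  then have "A \<in> torus_sets"
    by (simp add: sigma_algebra.sets_measure_of_eq[OF sigma_algebra_torus_sets])
  then show "to_torus -` A \<inter> space lebesgue \<in> sets lebesgue"
    by (simp add: torus_sets_def)
qed simp

definition permute_coords :: "(3 \<Rightarrow> 3) \<Rightarrow> torus3 \<Rightarrow> torus3" where
  "permute_coords \<sigma> p = (\<chi> i. p $ \<sigma> i)"

abbreviation swap_coords :: "3 \<Rightarrow> 3 \<Rightarrow> torus3 \<Rightarrow> torus3" where
  "swap_coords i j \<equiv> permute_coords (Transposition.transpose i j)"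


section \<open>Square-integrable functions\<close>

text \<open>Elements of \<open>L\<^sup>2\<close> are represented by functions, and all notions below are invariant under
  (and, where they assert equality or uniqueness, formulated up to) almost everywhere equality.\<close>

definition L2 :: "'a measure \<Rightarrow> ('a \<Rightarrow> complex) set" where
  "L2 M = {f \<in> borel_measurable M. integrable M (\<lambda>x. (cmod (f x))\<^sup>2)}"

definition L2_inner :: "'a measure \<Rightarrow> ('a \<Rightarrow> complex) \<Rightarrow> ('a \<Rightarrow> complex) \<Rightarrow> complex" where
  "L2_inner M f g = (LINT x|M. f x * cnj (g x))"

definition L2_norm :: "'a measure \<Rightarrow> ('a \<Rightarrow> complex) \<Rightarrow> real" where
  "L2_norm M f = sqrt (LINT x|M. (cmod (f x))\<^sup>2)"

text \<open>Closedness also forces invariance under almost everywhere equality (constant sequences).\<close>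

definition L2_closed_subspace :: "'a measure \<Rightarrow> ('a \<Rightarrow> complex) set \<Rightarrow> bool" where
  "L2_closed_subspace M V \<longleftrightarrow>
     V \<subseteq> L2 M \<and>
     (\<lambda>x. 0) \<in> V \<and>
     (\<forall>f\<in>V. \<forall>g\<in>V. (\<lambda>x. f x + g x) \<in> V) \<and>
     (\<forall>c. \<forall>f\<in>V. (\<lambda>x. c * f x) \<in> V) \<and>
     (\<forall>u. \<forall>f\<in>L2 M. (\<forall>n. u n \<in> V) \<longrightarrow>
        (\<lambda>n. L2_norm M (\<lambda>x. u n x - f x)) \<longlonglongrightarrow> 0 \<longrightarrow> f \<in> V)"

definition L2_orthogonal :: "'a measure \<Rightarrow> ('a \<Rightarrow> complex) set \<Rightarrow> ('a \<Rightarrow> complex) set \<Rightarrow> bool" where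
  "L2_orthogonal M V W \<longleftrightarrow> (\<forall>f\<in>V. \<forall>g\<in>W. L2_inner M f g = 0)"

text \<open>\<open>H\<close> is the internal orthogonal direct sum of the closed subspaces \<open>U\<close>, \<open>V\<close>, \<open>W\<close>.\<close>

definition L2_orthogonal_sum3 ::
  "'a measure \<Rightarrow> ('a \<Rightarrow> complex) set \<Rightarrow> ('a \<Rightarrow> complex) set \<Rightarrow> ('a \<Rightarrow> complex) set
    \<Rightarrow> ('a \<Rightarrow> complex) set \<Rightarrow> bool" where
  "L2_orthogonal_sum3 M H U V W \<longleftrightarrow>
     L2_closed_subspace M H \<and>
     L2_closed_subspace M U \<and> L2_closed_subspace M V \<and> L2_closed_subspace M W \<and>
     L2_orthogonal M U V \<and> L2_orthogonal M U W \<and> L2_orthogonal M V W \<and>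
     H = {f \<in> L2 M. \<exists>u\<in>U. \<exists>v\<in>V. \<exists>w\<in>W. AE x in M. f x = u x + v x + w x} \<and>
     (\<forall>u\<in>U. \<forall>v\<in>V. \<forall>w\<in>W. \<forall>u'\<in>U. \<forall>v'\<in>V. \<forall>w'\<in>W.
        (AE x in M. u x + v x + w x = u' x + v' x + w' x) \<longrightarrow>
        (AE x in M. u x = u' x) \<and> (AE x in M. v x = v' x) \<and> (AE x in M. w x = w' x))"


section \<open>Even functions on the torus and their symmetry classes\<close>

definition L2e :: "(torus3 \<Rightarrow> complex) set" where
  "L2e = {f \<in> L2 torus_measure. AE p in torus_measure. f (- p) = f p}"

definition L2e_s :: "(torus3 \<Rightarrow> complex) set" where
  "L2e_s = {f \<in> L2e. \<forall>\<sigma>. \<sigma> permutes UNIV \<longrightarrow>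
     (AE p in torus_measure. f (permute_coords \<sigma> p) = f p)}"

definition L2e_a12 :: "(torus3 \<Rightarrow> complex) set" where
  "L2e_a12 = {f \<in> L2e. AE p in torus_measure. f p = - f (swap_coords 1 2 p)}"

definition L2e_mix :: "(torus3 \<Rightarrow> complex) set" where
  "L2e_mix = {f \<in> L2e.
     (AE p in torus_measure. f p = f (swap_coords 1 2 p)) \<and>
     (\<exists>f1\<in>L2e. \<exists>f2\<in>L2e.
        (AE p in torus_measure. f p = f1 p + f2 p) \<and>
        (AE p in torus_measure. f1 p = - f1 (swap_coords 1 3 p)) \<and>
        (AE p in torus_measure. f2 p = - f2 (swap_coords 2 3 p)))}"

end

(* Composition with a coordinate permutation preserves the measure on the torus and hence the inner
   product, so a function and another one that transform with opposite signs under a transposition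
   are orthogonal; this gives all three orthogonality relations, and uniqueness follows. For a
   function g invariant under exchange of the first two coordinates, the average over all six
   permutations is u = (g + g o (13) + g o (23)) / 3, and g lies in the mixed space iff u = 0: then
   g = (g - g o (13)) / 3 + (g - g o (23)) / 3. This characterization is stable under limits, so the
   mixed space is closed, and it shows that g - u is mixed for every such g. A general even function
   f splits into (f + f o (12)) / 2 and (f - f o (12)) / 2. *)

theory Submission
  imports Defs
begin

section \<open>Measure-preserving maps\<close>

text \<open>Phrased through the push-forward so that the integration and almost-everywhere rules for
  \<open>distr\<close> apply directly.\<close>

definition measure_preserving_map :: "'a measure \<Rightarrow> ('a \<Rightarrow> 'a) \<Rightarrow> bool" where
  "measure_preserving_map M \<phi> \<longleftrightarrow> \<phi> \<in> M \<rightarrow>\<^sub>M M \<and> distr M M \<phi> = M"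

lemma measure_preserving_map_id: "measure_preserving_map M (\<lambda>x. x)"
  by (simp add: measure_preserving_map_def distr_id)

lemma measure_preserving_map_AE:
  assumes "measure_preserving_map M \<phi>" "AE x in M. P x"
  shows "AE x in M. P (\<phi> x)"
  using assms unfolding measure_preserving_map_def by (metis AE_distrD)

lemma measure_preserving_map_integral:
  fixes f :: "'a \<Rightarrow> 'b :: {banach, second_countable_topology}"
  assumes "measure_preserving_map M \<phi>" "f \<in> borel_measurable M"
  shows "(LINT x|M. f (\<phi> x)) = (LINT x|M. f x)"
  using assms integral_distr[of \<phi> M M f] by (simp add: measure_preserving_map_def)

lemma measure_preserving_map_integrable:
  fixes f :: "'a \<Rightarrow> 'b :: {banach, second_countable_topology}"
  assumes "measure_preserving_map M \<phi>" "f \<in> borel_measurable M"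
  shows "integrable M (\<lambda>x. f (\<phi> x)) \<longleftrightarrow> integrable M f"
  using assms integrable_distr_eq[of \<phi> M M f] by (simp add: measure_preserving_map_def)

text \<open>Null sets pull back to null sets, so measurability and invariance extend to the
  completion. This passes from \<open>lborel\<close>, where invariance is checked on boxes, to
  \<open>lebesgue\<close>.\<close>

lemma measure_preserving_map_completion:
  assumes "measure_preserving_map M \<phi>"
  shows "measure_preserving_map (completion M) \<phi>"
proof -
  have \<phi>: "\<phi> \<in> M \<rightarrow>\<^sub>M M" and d: "distr M M \<phi> = M"
    using assms by (auto simp: measure_preserving_map_def)
  have \<phi>': "\<phi> \<in> completion M \<rightarrow>\<^sub>M M"
    using \<phi> by (rule measurable_completion)
  have d': "distr (completion M) M \<phi> = M"
    using distr_completion[OF \<phi>] d by simp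
  interpret completion: complete_measure "completion M" ..
  have "\<phi> \<in> completion M \<rightarrow>\<^sub>M completion M"
    by (rule completion.measurable_completion2[OF \<phi>']) (simp add: d')
  moreover have "distr (completion M) (completion M) \<phi> = completion M"
    using completion.completion_distr_eq[OF \<phi>'] d' by simp
  ultimately show ?thesis by (simp add: measure_preserving_map_def)
qed


section \<open>Subspaces of square-integrable functions\<close>

lemma borel_measurable_cnj [measurable]:
  "f \<in> borel_measurable M \<Longrightarrow> (\<lambda>x. cnj (f x)) \<in> borel_measurable M"
  by (rule borel_measurable_continuous_on[OF continuous_on_cnj[OF continuous_on_id]])

lemma L2_borel_measurable: "f \<in> L2 M \<Longrightarrow> f \<in> borel_measurable M"
  by (simp add: L2_def)

lemma L2_zero: "(\<lambda>x. 0) \<in> L2 M"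
  by (simp add: L2_def)

lemma L2_cmult:
  assumes "f \<in> L2 M"
  shows "(\<lambda>x. c * f x) \<in> L2 M"
  using assms by (auto simp: L2_def norm_mult power_mult_distrib)

lemma norm_add_power2_le: "(norm (a + b))\<^sup>2 \<le> 2 * (norm a)\<^sup>2 + 2 * (norm b)\<^sup>2"
  for a b :: "'a :: real_normed_vector"
proof -
  have "(norm (a + b))\<^sup>2 \<le> (norm a + norm b)\<^sup>2"
    by (intro power_mono norm_triangle_ineq) auto
  also have "\<dots> \<le> 2 * (norm a)\<^sup>2 + 2 * (norm b)\<^sup>2"
    using zero_le_power2[of "norm a - norm b"] by (simp add: power2_eq_square algebra_simps)
  finally show ?thesis .
qed

lemma L2_add:
  assumes "f \<in> L2 M" "g \<in> L2 M"
  shows "(\<lambda>x. f x + g x) \<in> L2 M"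
proof -
  have [measurable]: "f \<in> borel_measurable M" "g \<in> borel_measurable M"
    using assms by (auto simp: L2_def)
  have "integrable M (\<lambda>x. 2 * (cmod (f x))\<^sup>2 + 2 * (cmod (g x))\<^sup>2)"
    using assms by (auto simp: L2_def)
  then have "integrable M (\<lambda>x. (cmod (f x + g x))\<^sup>2)"
    by (rule Bochner_Integration.integrable_bound)
       (auto intro!: AE_I2 order_trans[OF norm_add_power2_le])
  then show ?thesis by (simp add: L2_def)
qed

lemma L2_diff:
  assumes "f \<in> L2 M" "g \<in> L2 M"
  shows "(\<lambda>x. f x - g x) \<in> L2 M"
  using L2_add[OF assms(1) L2_cmult[OF assms(2), of "-1"]] by simp

lemma L2_compose:
  assumes "measure_preserving_map M \<phi>" "f \<in> L2 M"
  shows "(\<lambda>x. f (\<phi> x)) \<in> L2 M"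
proof -
  have [measurable]: "f \<in> borel_measurable M" "\<phi> \<in> M \<rightarrow>\<^sub>M M"
    using assms by (auto simp: L2_def measure_preserving_map_def)
  show ?thesis
    using measure_preserving_map_integrable[OF assms(1), of "\<lambda>x. (cmod (f x))\<^sup>2"] assms(2)
    by (simp add: L2_def)
qed

section \<open>The inner product and orthogonality\<close>

lemma L2_integrable_mult_cnj:
  assumes "f \<in> L2 M" "g \<in> L2 M"
  shows "integrable M (\<lambda>x. f x * cnj (g x))"
proof -
  have [measurable]: "f \<in> borel_measurable M" "g \<in> borel_measurable M"
    using assms by (auto simp: L2_def)
  have "integrable M (\<lambda>x. (cmod (f x))\<^sup>2 + (cmod (g x))\<^sup>2)"
    using assms by (auto simp: L2_def)
  then show ?thesis
  proof (rule Bochner_Integration.integrable_bound, goal_cases)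
    case 2
    \<comment> \<open>Nonnegativity of (a - b)^2 gives 2ab \<le> a^2 + b^2, and ab \<le>
      2ab.\<close>
    have "a * b \<le> a\<^sup>2 + b\<^sup>2" if "0 \<le> a" "0 \<le> b" for a b :: real
      using zero_le_power2[of "a - b"] mult_nonneg_nonneg[OF that]
      by (simp add: power2_eq_square algebra_simps)
    then show ?case by (auto simp: norm_mult)
  qed measurable
qed

lemma L2_norm_power2: "(L2_norm M f)\<^sup>2 = (LINT x|M. (cmod (f x))\<^sup>2)"
  by (simp add: L2_norm_def integral_nonneg_AE)

lemma L2_inner_add_right:
  assumes "f \<in> L2 M" "g \<in> L2 M" "h \<in> L2 M"
  shows "L2_inner M f (\<lambda>x. g x + h x) = L2_inner M f g + L2_inner M f h"
  using L2_integrable_mult_cnj[OF assms(1,2)] L2_integrable_mult_cnj[OF assms(1,3)]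
  by (simp add: L2_inner_def distrib_left)

lemma L2_inner_cnj: "L2_inner M g f = cnj (L2_inner M f g)"
  by (simp add: L2_inner_def mult.commute flip: Bochner_Integration.integral_cnj)

lemma L2_inner_cong:
  assumes "f \<in> L2 M" "g \<in> L2 M" "h \<in> L2 M" "AE x in M. g x = h x"
  shows "L2_inner M f g = L2_inner M f h"
  unfolding L2_inner_def
proof (rule integral_cong_AE)
  have [measurable]: "f \<in> borel_measurable M" "g \<in> borel_measurable M" "h \<in> borel_measurable M"
    using assms by (auto simp: L2_def)
  show "(\<lambda>x. f x * cnj (g x)) \<in> borel_measurable M" "(\<lambda>x. f x * cnj (h x)) \<in> borel_measurable M"
    by measurable
  show "AE x in M. f x * cnj (g x) = f x * cnj (h x)"
    using assms(4) by eventually_elim simp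
qed

lemma L2_inner_self_eq_0:
  assumes "f \<in> L2 M" "L2_inner M f f = 0"
  shows "AE x in M. f x = 0"
proof -
  have "complex_of_real (LINT x|M. (cmod (f x))\<^sup>2) = 0"
    using assms(2) unfolding L2_inner_def
    by (simp only: complex_norm_square flip: integral_complex_of_real)
  then have "(LINT x|M. (cmod (f x))\<^sup>2) = 0" by simp
  then show ?thesis
    using assms(1) by (subst (asm) integral_nonneg_eq_0_iff_AE) (auto simp: L2_def)
qed

text \<open>Changing variables along \<phi> turns the inner product into its own negative.\<close>

lemma L2_inner_eq_0_if_antisymmetric:
  assumes \<phi>: "measure_preserving_map M \<phi>" and fg: "f \<in> L2 M" "g \<in> L2 M"
    and anti: "AE x in M. f (\<phi> x) * cnj (g (\<phi> x)) = - (f x * cnj (g x))"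
  shows "L2_inner M f g = 0"
proof -
  have [measurable]: "f \<in> borel_measurable M" "g \<in> borel_measurable M" "\<phi> \<in> M \<rightarrow>\<^sub>M M"
    using \<phi> fg by (auto simp: L2_def measure_preserving_map_def)
  have "L2_inner M f g = (LINT x|M. f (\<phi> x) * cnj (g (\<phi> x)))"
    using measure_preserving_map_integral[OF \<phi>, of "\<lambda>x. f x * cnj (g x)"]
    by (simp add: L2_inner_def)
  also have "\<dots> = (LINT x|M. - (f x * cnj (g x)))"
    by (rule integral_cong_AE) (use anti in measurable)
  also have "\<dots> = - L2_inner M f g"
    by (simp add: L2_inner_def)
  finally show ?thesis by simp
qed

text \<open>Pairing the vanishing sum with \<open>u\<close> leaves only the inner product of
  \<open>u\<close> with itself. Applied to each summand in turn, this gives uniqueness of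
  decompositions.\<close>

lemma L2_orthogonal_add_eq_0:
  assumes uvw: "u \<in> L2 M" "v \<in> L2 M" "w \<in> L2 M"
    and orth: "L2_inner M u v = 0" "L2_inner M u w = 0"
    and 0: "AE x in M. u x + v x + w x = 0"
  shows "AE x in M. u x = 0"
proof (rule L2_inner_self_eq_0[OF uvw(1)])
  have "L2_inner M u u = L2_inner M u (\<lambda>x. u x + v x + w x)"
    using uvw orth by (simp add: L2_inner_add_right L2_add)
  also have "\<dots> = L2_inner M u (\<lambda>x. 0)"
    using uvw 0 by (intro L2_inner_cong L2_add L2_zero)
  finally show "L2_inner M u u = 0" by (simp add: L2_inner_def)
qed

section \<open>Closed subspaces and the linear conditions that cut them out\<close>

lemma L2_closed_subspaceD:
  assumes "L2_closed_subspace M V"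
  shows "f \<in> V \<Longrightarrow> f \<in> L2 M"
    and "f \<in> V \<Longrightarrow> g \<in> V \<Longrightarrow> (\<lambda>x. f x + g x) \<in> V"
    and "f \<in> V \<Longrightarrow> (\<lambda>x. c * f x) \<in> V"
  using assms by (auto simp: L2_closed_subspace_def)

lemma L2_closed_subspace_diff:
  assumes V: "L2_closed_subspace M V" and fg: "f \<in> V" "g \<in> V"
  shows "(\<lambda>x. f x - g x) \<in> V"
  using L2_closed_subspaceD(2)[OF V fg(1) L2_closed_subspaceD(3)[OF V fg(2), of "-1"]] by simp

text \<open>The constant sequence \<open>f\<close> converges to \<open>g\<close> in norm.\<close>

lemma L2_closed_subspace_AE_cong:
  assumes V: "L2_closed_subspace M V" and f: "f \<in> V" and g: "g \<in> L2 M"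
    and eq: "AE x in M. g x = f x"
  shows "g \<in> V"
proof -
  have [measurable]: "f \<in> borel_measurable M" "g \<in> borel_measurable M"
    using f g L2_closed_subspaceD(1)[OF V] by (auto simp: L2_def)
  have "(LINT x|M. (cmod (f x - g x))\<^sup>2) = (LINT x|M. 0)"
    by (rule integral_cong_AE) (use eq in auto)
  then have "L2_norm M (\<lambda>x. f x - g x) = 0" by (simp add: L2_norm_def)
  then have "(\<lambda>n::nat. L2_norm M (\<lambda>x. f x - g x)) \<longlonglongrightarrow> 0" by simp
  then show ?thesis
    using V f g unfolding L2_closed_subspace_def by (elim conjE) (erule allE[of _ "\<lambda>_. f"], auto)
qed

lemma L2_closed_subspace_Inter:
  assumes "\<V> \<noteq> {}" "\<And>V. V \<in> \<V> \<Longrightarrow> L2_closed_subspace M V"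
  shows "L2_closed_subspace M (\<Inter>\<V>)"
  unfolding L2_closed_subspace_def
proof (intro conjI ballI allI impI)
  show "\<Inter>\<V> \<subseteq> L2 M"
    using assms unfolding L2_closed_subspace_def by blast
next
  fix u f
  assume "f \<in> L2 M" "\<forall>n. u n \<in> \<Inter>\<V>" "(\<lambda>n. L2_norm M (\<lambda>x. u n x - f x)) \<longlonglongrightarrow> 0"
  then show "f \<in> \<Inter>\<V>"
    using assms(2) unfolding L2_closed_subspace_def by blast
qed (use assms(2) in \<open>simp_all add: L2_closed_subspace_def\<close>)

text \<open>A common form for the symmetry conditions: each becomes the kernel of one such operator,
  so closedness has to be proved only once.\<close>

definition weighted_compose :: "(complex \<times> ('a \<Rightarrow> 'a)) list \<Rightarrow> ('a \<Rightarrow> complex) \<Rightarrow> 'a \<Rightarrow> complex" where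
  "weighted_compose xs f x = (\<Sum>(c, \<phi>)\<leftarrow>xs. c * f (\<phi> x))"

lemma weighted_compose_Nil: "weighted_compose [] f x = 0"
  by (simp add: weighted_compose_def)

lemma weighted_compose_Cons:
  "weighted_compose ((c, \<phi>) # xs) f x = c * f (\<phi> x) + weighted_compose xs f x"
  by (simp add: weighted_compose_def)

lemma weighted_compose_zero: "weighted_compose xs (\<lambda>x. 0) x = 0"
  by (induction xs) (auto simp: weighted_compose_Nil weighted_compose_Cons)

lemma weighted_compose_add:
  "weighted_compose xs (\<lambda>x. f x + g x) x = weighted_compose xs f x + weighted_compose xs g x"
  by (induction xs) (auto simp: weighted_compose_Nil weighted_compose_Cons algebra_simps)

lemma weighted_compose_cmult:
  "weighted_compose xs (\<lambda>x. k * f x) x = k * weighted_compose xs f x"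
  by (induction xs) (auto simp: weighted_compose_Nil weighted_compose_Cons algebra_simps)

lemma weighted_compose_diff:
  "weighted_compose xs (\<lambda>x. f x - g x) x = weighted_compose xs f x - weighted_compose xs g x"
  using weighted_compose_add[of xs f "\<lambda>x. -1 * g x" x] weighted_compose_cmult[of xs "-1" g x]
  by simp

lemma weighted_compose_L2:
  assumes "\<forall>\<phi>\<in>snd ` set xs. measure_preserving_map M \<phi>" "f \<in> L2 M"
  shows "weighted_compose xs f \<in> L2 M"
  using assms(1)
proof (induction xs)
  case Nil
  then show ?case by (simp add: weighted_compose_Nil[abs_def] L2_zero)
next
  case (Cons y xs)
  obtain c \<phi> where y: "y = (c, \<phi>)" by (cases y)
  have "(\<lambda>x. c * f (\<phi> x)) \<in> L2 M"
    using Cons.prems y by (intro L2_cmult L2_compose[OF _ assms(2)]) auto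
  moreover have "weighted_compose xs f \<in> L2 M"
    using Cons by simp
  ultimately show ?case
    unfolding y weighted_compose_Cons[abs_def] by (rule L2_add)
qed

text \<open>Composition with a measure-preserving map is an isometry, so a finite weighted sum is a
  bounded operator. Each list entry enlarges the constant through
  \<open>norm_add_power2_le\<close>.\<close>

lemma weighted_compose_bounded:
  assumes "\<forall>\<phi>\<in>snd ` set xs. measure_preserving_map M \<phi>"
  shows "\<exists>K. \<forall>f\<in>L2 M.
    (LINT x|M. (cmod (weighted_compose xs f x))\<^sup>2) \<le> K * (LINT x|M. (cmod (f x))\<^sup>2)"
  using assms
proof (induction xs)
  case Nil
  show ?case by (intro exI[of _ 0]) (simp add: weighted_compose_Nil)
next
  case (Cons y xs)
  obtain c \<phi> where y: "y = (c, \<phi>)" by (cases y)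
  have \<phi>: "measure_preserving_map M \<phi>" using Cons.prems y by auto
  have xs: "\<forall>\<phi>\<in>snd ` set xs. measure_preserving_map M \<phi>"
    using Cons.prems by auto
  obtain K where K: "\<And>f. f \<in> L2 M \<Longrightarrow>
    (LINT x|M. (cmod (weighted_compose xs f x))\<^sup>2) \<le> K * (LINT x|M. (cmod (f x))\<^sup>2)"
    using Cons.IH xs by blast
  have "(LINT x|M. (cmod (weighted_compose (y # xs) f x))\<^sup>2)
      \<le> (2 * (cmod c)\<^sup>2 + 2 * K) * (LINT x|M. (cmod (f x))\<^sup>2)" if f: "f \<in> L2 M" for f
  proof -
    note [simp] = L2_compose[OF \<phi> f] weighted_compose_L2[OF xs f]
    have int: "integrable M (\<lambda>x. (cmod (h x))\<^sup>2)" if "h \<in> L2 M" for h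
      using that by (simp add: L2_def)
    have \<phi>_eq: "(LINT x|M. (cmod (f (\<phi> x)))\<^sup>2) = (LINT x|M. (cmod (f x))\<^sup>2)"
      using measure_preserving_map_integral[OF \<phi>, of "\<lambda>x. (cmod (f x))\<^sup>2"]
        L2_borel_measurable[OF f] by simp
    have "(LINT x|M. (cmod (weighted_compose (y # xs) f x))\<^sup>2)
        \<le> (LINT x|M. 2 * (cmod (c * f (\<phi> x)))\<^sup>2 + 2 * (cmod (weighted_compose xs f x))\<^sup>2)"
      unfolding y weighted_compose_Cons
      by (intro integral_mono norm_add_power2_le Bochner_Integration.integrable_add
            integrable_mult_right int L2_add L2_cmult) simp_all
    also have "\<dots> = 2 * (cmod c)\<^sup>2 * (LINT x|M. (cmod (f (\<phi> x)))\<^sup>2)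
        + 2 * (LINT x|M. (cmod (weighted_compose xs f x))\<^sup>2)"
      using int[OF L2_compose[OF \<phi> f]] int[OF weighted_compose_L2[OF xs f]]
      by (simp add: norm_mult power_mult_distrib mult.assoc)
    also have "\<dots> \<le> (2 * (cmod c)\<^sup>2 + 2 * K) * (LINT x|M. (cmod (f x))\<^sup>2)"
      using K[OF f] by (simp add: \<phi>_eq algebra_simps)
    finally show ?thesis .
  qed
  then show ?case by blast
qed

text \<open>The kernel of a bounded operator is closed.\<close>

lemma L2_closed_subspace_weighted_compose:
  assumes mp: "\<forall>\<phi>\<in>snd ` set xs. measure_preserving_map M \<phi>"
  shows "L2_closed_subspace M {f \<in> L2 M. AE x in M. weighted_compose xs f x = 0}"
    (is "L2_closed_subspace M ?V")
  unfolding L2_closed_subspace_def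
proof (intro conjI ballI allI impI)
  show "(\<lambda>x. 0) \<in> ?V" by (simp add: L2_zero weighted_compose_zero)
  show "(\<lambda>x. f x + g x) \<in> ?V" if fg: "f \<in> ?V" "g \<in> ?V" for f g
  proof -
    have "AE x in M. weighted_compose xs f x = 0" "AE x in M. weighted_compose xs g x = 0"
      using fg by auto
    then have "AE x in M. weighted_compose xs (\<lambda>x. f x + g x) x = 0"
      by eventually_elim (simp add: weighted_compose_add)
    then show ?thesis using fg by (simp add: L2_add)
  qed
  show "(\<lambda>x. c * f x) \<in> ?V" if "f \<in> ?V" for c f
    using that by (auto simp: L2_cmult weighted_compose_cmult)
next
  fix u f
  assume f: "f \<in> L2 M" and u: "\<forall>n. u n \<in> ?V"
    and lim: "(\<lambda>n. L2_norm M (\<lambda>x. u n x - f x)) \<longlonglongrightarrow> 0"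
  obtain K where K: "\<And>f. f \<in> L2 M \<Longrightarrow>
    (LINT x|M. (cmod (weighted_compose xs f x))\<^sup>2) \<le> K * (LINT x|M. (cmod (f x))\<^sup>2)"
    using weighted_compose_bounded[OF mp] by blast
  let ?I = "LINT x|M. (cmod (weighted_compose xs f x))\<^sup>2"
  have bound: "?I \<le> K * (L2_norm M (\<lambda>x. u n x - f x))\<^sup>2" for n
  proof -
    have un: "u n \<in> L2 M" "AE x in M. weighted_compose xs (u n) x = 0" using u by auto
    have d: "(\<lambda>x. u n x - f x) \<in> L2 M" using un f by (simp add: L2_diff)
    have sq: "(\<lambda>x. (cmod (h x))\<^sup>2) \<in> borel_measurable M"
      if "h \<in> borel_measurable M" for h
      using that by measurable
    have F: "weighted_compose xs f \<in> borel_measurable M"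
      "weighted_compose xs (\<lambda>x. u n x - f x) \<in> borel_measurable M"
      using weighted_compose_L2[OF mp] f d by (simp_all add: L2_borel_measurable)
    \<comment> \<open>The operator annihilates \<open>u n\<close>, so its values at \<open>f\<close>
      and at \<open>u n - f\<close> differ only in sign.\<close>
    have "?I = (LINT x|M. (cmod (weighted_compose xs (\<lambda>x. u n x - f x) x))\<^sup>2)"
    proof (rule integral_cong_AE)
      show "AE x in M. (cmod (weighted_compose xs f x))\<^sup>2
          = (cmod (weighted_compose xs (\<lambda>x. u n x - f x) x))\<^sup>2"
        using un(2) by eventually_elim (simp add: weighted_compose_diff)
    qed (rule sq F)+
    also have "\<dots> \<le> K * (L2_norm M (\<lambda>x. u n x - f x))\<^sup>2"
      using K[OF d] by (simp add: L2_norm_power2)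
    finally show ?thesis .
  qed
  have "(\<lambda>n. K * (L2_norm M (\<lambda>x. u n x - f x))\<^sup>2) \<longlonglongrightarrow> K * 0\<^sup>2"
    by (intro tendsto_mult tendsto_power tendsto_const lim)
  then have "?I \<le> K * 0\<^sup>2"
    by (rule LIMSEQ_le_const) (use bound in auto)
  moreover have "?I \<ge> 0" by (intro integral_nonneg_AE) auto
  ultimately have "?I = 0" by simp
  then have "AE x in M. weighted_compose xs f x = 0"
    using weighted_compose_L2[OF mp f]
    by (subst (asm) integral_nonneg_eq_0_iff_AE) (auto simp: L2_def)
  then show "f \<in> ?V" using f by simp
qed auto

text \<open>The case c = 1 describes invariance under \<phi>, the case c = -1 a change of
  sign.\<close>

lemma L2_closed_subspace_AE_compose_eq:
  assumes "measure_preserving_map M \<phi>"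
  shows "L2_closed_subspace M {f \<in> L2 M. AE x in M. f (\<phi> x) = c * f x}"
proof -
  have "L2_closed_subspace M
    {f \<in> L2 M. AE x in M. weighted_compose [(1, \<phi>), (-c, \<lambda>x. x)] f x = 0}"
    by (rule L2_closed_subspace_weighted_compose) (use assms measure_preserving_map_id in auto)
  then show ?thesis by (simp add: weighted_compose_Cons weighted_compose_Nil)
qed

text \<open>Existence of a decomposition is all that remains to be shown beyond closedness,
  orthogonality and inclusion: uniqueness follows from orthogonality, and sums stay in
  \<open>H\<close> because it is a subspace stable under almost everywhere equality.\<close>

lemma L2_orthogonal_sum3I:
  assumes H: "L2_closed_subspace M H" and U: "L2_closed_subspace M U"
    and V: "L2_closed_subspace M V" and W: "L2_closed_subspace M W"
    and orth: "L2_orthogonal M U V" "L2_orthogonal M U W" "L2_orthogonal M V W"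
    and sub: "U \<subseteq> H" "V \<subseteq> H" "W \<subseteq> H"
    and decomp: "\<And>f. f \<in> H \<Longrightarrow> \<exists>u\<in>U. \<exists>v\<in>V. \<exists>w\<in>W. AE x in M. f x = u x + v x + w x"
  shows "L2_orthogonal_sum3 M H U V W"
  unfolding L2_orthogonal_sum3_def
proof (intro conjI ballI impI)
  show "H = {f \<in> L2 M. \<exists>u\<in>U. \<exists>v\<in>V. \<exists>w\<in>W. AE x in M. f x = u x + v x + w x}"
  proof (intro equalityI subsetI)
    fix f assume "f \<in> {f \<in> L2 M. \<exists>u\<in>U. \<exists>v\<in>V. \<exists>w\<in>W. AE x in M. f x = u x + v x + w x}"
    then obtain u v w where f: "f \<in> L2 M" and "u \<in> U" "v \<in> V" "w \<in> W"
      and eq: "AE x in M. f x = u x + v x + w x"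
      by blast
    then have uvw: "u \<in> H" "v \<in> H" "w \<in> H"
      using sub by blast+
    have "(\<lambda>x. u x + v x + w x) \<in> H"
      by (intro L2_closed_subspaceD(2)[OF H] uvw)
    then show "f \<in> H"
      using f eq by (rule L2_closed_subspace_AE_cong[OF H])
  qed (use decomp L2_closed_subspaceD(1)[OF H] in blast)
next
  fix u v w u' v' w'
  assume mem: "u \<in> U" "v \<in> V" "w \<in> W" "u' \<in> U" "v' \<in> V" "w' \<in> W"
    and eq: "AE x in M. u x + v x + w x = u' x + v' x + w' x"
  \<comment> \<open>The differences of two decompositions are pairwise orthogonal and add up to
    zero.\<close>
  define a b c where abc_def: "a = (\<lambda>x. u x - u' x)" "b = (\<lambda>x. v x - v' x)" "c = (\<lambda>x. w x - w' x)"
  have abc: "a \<in> U" "b \<in> V" "c \<in> W"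
    using mem U V W by (auto simp: abc_def intro: L2_closed_subspace_diff)
  then have L: "a \<in> L2 M" "b \<in> L2 M" "c \<in> L2 M"
    using U V W L2_closed_subspaceD(1) by blast+
  have inner: "L2_inner M a b = 0" "L2_inner M a c = 0" "L2_inner M b c = 0"
    using orth abc by (auto simp: L2_orthogonal_def)
  then have inner': "L2_inner M b a = 0" "L2_inner M c a = 0" "L2_inner M c b = 0"
    using L2_inner_cnj[of M b a] L2_inner_cnj[of M c a] L2_inner_cnj[of M c b] by auto
  have 0: "AE x in M. a x + b x + c x = 0"
    using eq by eventually_elim (simp add: abc_def algebra_simps)
  show "AE x in M. u x = u' x"
    using L2_orthogonal_add_eq_0[OF L inner(1,2) 0] by (simp add: abc_def)
  show "AE x in M. v x = v' x"
    using L2_orthogonal_add_eq_0[OF L(2,1,3) inner'(1) inner(3)] 0 by (simp add: abc_def add_ac)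
  show "AE x in M. w x = w' x"
    using L2_orthogonal_add_eq_0[OF L(3,1,2) inner'(2,3)] 0 by (simp add: abc_def add_ac)
qed (fact H U V W orth)+


section \<open>Symmetries of the torus\<close>

text \<open>Lebesgue measure is determined by its values on boxes. The preimage of a box is a box
  with permuted sides, and the product of the side lengths is unchanged.\<close>

lemma lborel_permute_vec:
  fixes \<sigma> :: "'n::finite \<Rightarrow> 'n"
  assumes \<sigma>: "\<sigma> permutes UNIV"
  shows "measure_preserving_map lborel (\<lambda>x::real^'n. \<chi> i. x $ \<sigma> i)"
proof -
  let ?T = "\<lambda>x::real^'n. \<chi> i. x $ \<sigma> i"
  have "linear ?T"
    by (rule linearI) (auto simp: vec_eq_iff)
  then have T: "?T \<in> borel \<rightarrow>\<^sub>M borel"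
    by (intro borel_measurable_continuous_onI linear_continuous_on linear_conv_bounded_linear[THEN iffD1])
  have inv: "\<sigma> (inv \<sigma> i) = i" "inv \<sigma> (\<sigma> i) = i" for i
    using permutes_inverses[OF \<sigma>] by auto
  have prod: "(\<Prod>b\<in>Basis. (u - l) \<bullet> b) = (\<Prod>i\<in>UNIV. u $ i - l $ i)" for u l :: "real^'n"
  proof -
    have B: "(Basis :: (real^'n) set) = (\<lambda>i. axis i 1) ` UNIV" by (auto simp: Basis_vec_def)
    show ?thesis
      unfolding B by (subst prod.reindex) (auto simp: inj_on_def axis_eq_axis inner_axis)
  qed
  have "lborel = distr lborel lborel ?T"
  proof (rule lborel_eqI)
    fix l u :: "real^'n" assume le: "\<And>b. b \<in> Basis \<Longrightarrow> l \<bullet> b \<le> u \<bullet> b"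
    then have le': "l $ i \<le> u $ i" for i
      by (metis axis_in_Basis_iff cart_eq_inner_axis Basis_real_def insertI1)
    let ?l = "\<chi> i. l $ inv \<sigma> i" and ?u = "\<chi> i. u $ inv \<sigma> i"
    have vim: "?T -` box l u = box ?l ?u"
    proof (intro set_eqI)
      fix x
      have "(\<forall>i. l $ i < x $ \<sigma> i \<and> x $ \<sigma> i < u $ i)
        \<longleftrightarrow> (\<forall>i. l $ inv \<sigma> i < x $ i \<and> x $ i < u $ inv \<sigma> i)"
        by (metis inv)
      then show "x \<in> ?T -` box l u \<longleftrightarrow> x \<in> box ?l ?u"
        by (simp add: mem_box_cart)
    qed
    have "emeasure (distr lborel lborel ?T) (box l u) = emeasure lborel (box ?l ?u)"
      using T by (subst emeasure_distr) (auto simp: vim)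
    also have "\<dots> = (\<Prod>b\<in>Basis. (?u - ?l) \<bullet> b)"
      by (rule emeasure_lborel_box) (auto simp: Basis_vec_def inner_axis le')
    also have "(\<Prod>b\<in>Basis. (?u - ?l) \<bullet> b) = (\<Prod>i\<in>UNIV. u $ inv \<sigma> i - l $ inv \<sigma> i)"
      by (subst prod) simp
    also have "\<dots> = (\<Prod>i\<in>UNIV. u $ i - l $ i)"
      by (rule prod.permute[OF permutes_inv[OF \<sigma>], symmetric, unfolded o_def])
    also have "\<dots> = (\<Prod>b\<in>Basis. (u - l) \<bullet> b)" by (simp add: prod)
    finally show "emeasure (distr lborel lborel ?T) (box l u) = (\<Prod>b\<in>Basis. (u - l) \<bullet> b)" .
  qed simp
  then show ?thesis using T by (simp add: measure_preserving_map_def)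
qed

text \<open>An affine map with linear factor -1 has Jacobian of absolute value 1.\<close>

lemma lborel_reflection: "measure_preserving_map lborel (\<lambda>x::'a::euclidean_space. a - x)"
proof -
  have "lborel = density (distr lborel borel (\<lambda>x. a + (-1) *\<^sub>R x)) (\<lambda>_. ennreal (\<bar>-1\<bar> ^ DIM('a)))"
    by (rule lborel_affine) simp
  also have "\<dots> = distr lborel lborel (\<lambda>x. a - x)"
    by (simp add: density_1 cong: distr_cong)
  finally show ?thesis by (simp add: measure_preserving_map_def)
qed

text \<open>The reflection x \<mapsto> 2 * pi - x does not preserve the half-open
  \<open>fundamental_cube\<close>, but it preserves the open cube, which differs from it by a null
  set.\<close>

definition open_cube :: "(real ^ 3) set" where
  "open_cube = box 0 (\<chi> i. 2 * pi)"

lemma mem_open_cube: "x \<in> open_cube \<longleftrightarrow> (\<forall>i. 0 < x $ i \<and> x $ i < 2 * pi)"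
  by (simp add: open_cube_def mem_box_cart)

lemma open_cube_subset: "open_cube \<subseteq> fundamental_cube"
  by (auto simp: mem_open_cube fundamental_cube_def less_imp_le)

lemma cube_diff_null: "fundamental_cube - open_cube \<in> null_sets lebesgue"
proof -
  have "negligible (cbox 0 (\<chi> i. 2 * pi) - box 0 (\<chi> i. 2 * pi) :: (real^3) set)"
    by (rule negligible_frontier_interval)
  moreover have "fundamental_cube - open_cube \<subseteq> cbox 0 (\<chi> i. 2 * pi) - box 0 (\<chi> i. 2 * pi)"
    by (auto simp: open_cube_def fundamental_cube_def mem_box_cart less_imp_le)
  ultimately show ?thesis
    using negligible_subset negligible_iff_null_sets by blast
qed

text \<open>An open box together with a null set.\<close>

lemma fundamental_cube_lebesgue: "fundamental_cube \<in> sets lebesgue"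
proof -
  have "open_cube \<in> sets lebesgue"
    by (simp add: open_cube_def)
  then have "open_cube \<union> (fundamental_cube - open_cube) \<in> sets lebesgue"
    using cube_diff_null by (intro sets.Un) auto
  then show ?thesis using open_cube_subset by (simp add: Un_absorb1)
qed

lemma emeasure_torus:
  assumes "A \<in> torus_sets"
  shows "emeasure torus_measure A = emeasure lebesgue (to_torus -` A \<inter> open_cube)"
proof -
  have A: "to_torus -` A \<in> sets lebesgue" using assms by (simp add: torus_sets_def)
  have "emeasure torus_measure A
      = emeasure (restrict_space lebesgue fundamental_cube) (to_torus -` A \<inter> fundamental_cube)"
    using assms unfolding torus_measure_def
    by (subst emeasure_distr[OF measurable_to_torus])
       (auto simp: sigma_algebra.sets_measure_of_eq[OF sigma_algebra_torus_sets] space_restrict_space)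
  also have "\<dots> = emeasure lebesgue (to_torus -` A \<inter> fundamental_cube)"
    using fundamental_cube_lebesgue by (subst emeasure_restrict_space) auto
  also have "\<dots> = emeasure lebesgue
      ((to_torus -` A \<inter> open_cube) \<union> (to_torus -` A \<inter> (fundamental_cube - open_cube)))"
    using open_cube_subset by (intro arg_cong[of _ _ "emeasure lebesgue"]) auto
  also have "\<dots> = emeasure lebesgue (to_torus -` A \<inter> open_cube)"
    using A cube_diff_null
    by (intro emeasure_Un_null_set null_set_Int1 null_set_Int2 sets.Int) (auto simp: open_cube_def)
  finally show ?thesis .
qed

text \<open>Invariance on the torus is reduced to a lift \<psi> on \<open>real ^ 3\<close>:
  preimages under \<phi> lift to preimages under \<psi>, and torus measure is Lebesgue measure on
  the open cube, which \<psi> respects.\<close>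

lemma measure_preserving_map_torus:
  assumes \<psi>: "measure_preserving_map lborel \<psi>"
    and lift: "\<And>x. \<phi> (to_torus x) = to_torus (\<psi> x)"
    and cube: "\<And>x. \<psi> x \<in> open_cube \<longleftrightarrow> x \<in> open_cube"
  shows "measure_preserving_map torus_measure \<phi>"
proof -
  have \<psi>': "\<psi> \<in> lebesgue \<rightarrow>\<^sub>M lebesgue" "distr lebesgue lebesgue \<psi> = lebesgue"
    using measure_preserving_map_completion[OF \<psi>] by (auto simp: measure_preserving_map_def)
  have vim: "to_torus -` \<phi> -` A = \<psi> -` to_torus -` A" for A
    using lift by auto
  have tor: "\<phi> -` A \<in> torus_sets" if "A \<in> torus_sets" for A
    using measurable_sets[OF \<psi>'(1)] that unfolding torus_sets_def vim mem_Collect_eq by auto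
  have meas: "\<phi> \<in> torus_measure \<rightarrow>\<^sub>M torus_measure"
    by (rule measurableI) (auto simp: sets_torus_measure tor)
  have "distr torus_measure torus_measure \<phi> = torus_measure"
  proof (rule measure_eqI)
    fix A assume "A \<in> sets (distr torus_measure torus_measure \<phi>)"
    then have A: "A \<in> torus_sets" by (simp add: sets_torus_measure)
    then have A': "to_torus -` A \<inter> open_cube \<in> sets lebesgue"
      by (auto simp: torus_sets_def open_cube_def)
    have "emeasure (distr torus_measure torus_measure \<phi>) A = emeasure torus_measure (\<phi> -` A)"
      using A meas by (subst emeasure_distr) (auto simp: sets_torus_measure)
    \<comment> \<open>Invariance of the open cube moves the intersection inside the
      preimage.\<close>
    also have "\<dots> = emeasure lebesgue (\<psi> -` (to_torus -` A \<inter> open_cube))"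
      unfolding emeasure_torus[OF tor[OF A]] vim using cube
      by (intro arg_cong[of _ _ "emeasure lebesgue"]) auto
    also have "\<dots> = emeasure (distr lebesgue lebesgue \<psi>) (to_torus -` A \<inter> open_cube)"
      using \<psi>'(1) A' by (subst emeasure_distr) auto
    also have "\<dots> = emeasure torus_measure A"
      by (simp add: \<psi>'(2) emeasure_torus[OF A])
    finally show "emeasure (distr torus_measure torus_measure \<phi>) A = emeasure torus_measure A" .
  qed simp
  then show ?thesis using meas by (simp add: measure_preserving_map_def)
qed

section \<open>Invariance of torus measure under negation and permutations\<close>

lemma to_circle_reflect: "to_circle (2 * pi - x) = - to_circle x"
proof -
  have "[2 * pi - x = - x] (rmod (2 * pi))"
    \<comment> \<open>The witness -1 subtracts one period from \<open>2 * pi - x\<close>.\<close>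
    by (auto simp: rcong_altdef intro!: exI[of _ "-1"])
  then show ?thesis
    by (simp add: uminus_circle.abs_eq circle.abs_eq_iff)
qed

text \<open>Negation sends the cube to its opposite; translating back by the period turns it into
  the reflection \<open>x \<mapsto> 2 * pi - x\<close>, which preserves the open cube.\<close>

lemma measure_preserving_uminus: "measure_preserving_map torus_measure uminus"
proof (rule measure_preserving_map_torus[OF lborel_reflection[of "\<chi> i. 2 * pi"]])
  fix x
  show "- to_torus x = to_torus ((\<chi> i. 2 * pi) - x)"
    by (simp add: to_torus_def vec_eq_iff to_circle_reflect)
  show "(\<chi> i. 2 * pi) - x \<in> open_cube \<longleftrightarrow> x \<in> open_cube"
    by (auto simp: mem_open_cube)
qed

lemma measure_preserving_permute_coords:
  assumes \<sigma>: "\<sigma> permutes UNIV"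
  shows "measure_preserving_map torus_measure (permute_coords \<sigma>)"
proof (rule measure_preserving_map_torus[OF lborel_permute_vec[OF \<sigma>]])
  fix x
  show "permute_coords \<sigma> (to_torus x) = to_torus (\<chi> i. x $ \<sigma> i)"
    by (simp add: to_torus_def permute_coords_def)
  show "(\<chi> i. x $ \<sigma> i) \<in> open_cube \<longleftrightarrow> x \<in> open_cube"
    using permutes_inverses(1)[OF \<sigma>] by (auto simp: mem_open_cube) metis+
qed

lemma measure_preserving_swap_coords: "measure_preserving_map torus_measure (swap_coords i j)"
  by (intro measure_preserving_permute_coords permutes_swap_id) auto

section \<open>Composition rules for coordinate permutations\<close>

lemma permute_coords_permute_coords:
  "permute_coords \<sigma> (permute_coords \<tau> p) = permute_coords (\<tau> \<circ> \<sigma>) p"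
  by (simp add: permute_coords_def)

lemma permute_coords_uminus: "permute_coords \<sigma> (- p) = - permute_coords \<sigma> p"
  by (simp add: permute_coords_def vec_eq_iff)

lemma permute_coords_id: "permute_coords id p = p"
  by (simp add: permute_coords_def)

lemma swap_coords_swap_coords: "swap_coords i j (swap_coords i j p) = p"
  by (simp add: permute_coords_def vec_eq_iff)

text \<open>A product of two distinct transpositions is one of the two 3-cycles. Each 3-cycle gets a
  normal form with \<open>swap_coords 1 2\<close> outermost.\<close>

lemma swap_coords_conjugate:
  "swap_coords 1 3 (swap_coords 1 2 p) = swap_coords 1 2 (swap_coords 2 3 p)"
  "swap_coords 2 3 (swap_coords 1 2 p) = swap_coords 1 2 (swap_coords 1 3 p)"
  "swap_coords 1 3 (swap_coords 2 3 p) = swap_coords 1 2 (swap_coords 1 3 p)"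
  "swap_coords 2 3 (swap_coords 1 3 p) = swap_coords 1 2 (swap_coords 2 3 p)"
  by (auto simp: permute_coords_def vec_eq_iff forall_3 Transposition.transpose_def)

section \<open>Closedness of the function spaces\<close>

lemma L2e_closed: "L2_closed_subspace torus_measure L2e"
  using L2_closed_subspace_AE_compose_eq[OF measure_preserving_uminus, of 1] by (simp add: L2e_def)

text \<open>Negation acts coordinatewise, hence commutes with permutations.\<close>

lemma L2e_permute_coords:
  assumes "\<sigma> permutes UNIV" "f \<in> L2e"
  shows "(\<lambda>p. f (permute_coords \<sigma> p)) \<in> L2e"
proof -
  note mp = measure_preserving_permute_coords[OF assms(1)]
  have "AE p in torus_measure. f (- permute_coords \<sigma> p) = f (permute_coords \<sigma> p)"
    using measure_preserving_map_AE[OF mp, of "\<lambda>p. f (- p) = f p"] assms(2) by (simp add: L2e_def)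
  then show ?thesis
    using assms(2) L2_compose[OF mp] by (simp add: L2e_def permute_coords_uminus)
qed

lemma L2e_swap_coords: "f \<in> L2e \<Longrightarrow> (\<lambda>p. f (swap_coords i j p)) \<in> L2e"
  by (intro L2e_permute_coords permutes_swap_id) auto

lemmas L2e_add = L2_closed_subspaceD(2)[OF L2e_closed]
lemmas L2e_cmult = L2_closed_subspaceD(3)[OF L2e_closed]
lemmas L2e_diff = L2_closed_subspace_diff[OF L2e_closed]
lemmas L2e_L2 = L2_closed_subspaceD(1)[OF L2e_closed]

lemma L2e_s_closed: "L2_closed_subspace torus_measure L2e_s"
proof -
  let ?S = "\<lambda>\<sigma>. {f \<in> L2 torus_measure. AE p in torus_measure. f (permute_coords \<sigma> p) = 1 * f p}"
  have "L2_closed_subspace torus_measure (\<Inter>(insert L2e (?S ` {\<sigma>. \<sigma> permutes UNIV})))"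
    using L2e_closed
    by (intro L2_closed_subspace_Inter)
       (auto intro!: L2_closed_subspace_AE_compose_eq[of _ _ 1, simplified] measure_preserving_permute_coords)
  also have "\<Inter>(insert L2e (?S ` {\<sigma>. \<sigma> permutes UNIV})) = L2e_s"
    using L2e_L2 by (auto simp: L2e_s_def)
  finally show ?thesis .
qed

lemma L2e_a12_closed: "L2_closed_subspace torus_measure L2e_a12"
proof -
  let ?A = "{f \<in> L2 torus_measure. AE p in torus_measure. f (swap_coords 1 2 p) = (-1) * f p}"
  have "L2_closed_subspace torus_measure ?A"
    by (rule L2_closed_subspace_AE_compose_eq[OF measure_preserving_swap_coords])
  moreover have swap: "f p = - f (swap_coords 1 2 p) \<longleftrightarrow> f (swap_coords 1 2 p) = - f p"
    for f :: "torus3 \<Rightarrow> complex" and p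
    by auto
  ultimately have "L2_closed_subspace torus_measure (\<Inter>{L2e, ?A})"
    using L2e_closed by (intro L2_closed_subspace_Inter) auto
  also have "\<Inter>{L2e, ?A} = L2e_a12"
    using L2e_L2 by (auto simp: L2e_a12_def swap)
  finally show ?thesis .
qed

text \<open>For a function symmetric under exchange of the first two coordinates, the vanishing of the
  sum below is the vanishing of its full symmetrization.\<close>

lemma L2e_mix_eq:
  "L2e_mix = {f \<in> L2e. (AE p in torus_measure. f (swap_coords 1 2 p) = f p) \<and>
     (AE p in torus_measure. f p + f (swap_coords 1 3 p) + f (swap_coords 2 3 p) = 0)}"
  (is "_ = ?R")
proof (intro equalityI subsetI)
  fix f assume "f \<in> L2e_mix"
  then obtain f1 f2 where f: "f \<in> L2e"
    and sym: "AE p in torus_measure. f p = f (swap_coords 1 2 p)"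
    and sum: "AE p in torus_measure. f p = f1 p + f2 p"
    and anti1: "AE p in torus_measure. f1 p = - f1 (swap_coords 1 3 p)"
    and anti2: "AE p in torus_measure. f2 p = - f2 (swap_coords 2 3 p)"
    by (auto simp: L2e_mix_def)
  \<comment> \<open>\<open>Q\<close> collects the pointwise identities; they are needed at all six
    points of the permutation orbit of \<open>p\<close>, hence the shifted copies below.\<close>
  define Q where "Q p \<longleftrightarrow> f p = f (swap_coords 1 2 p) \<and> f p = f1 p + f2 p
    \<and> f1 p = - f1 (swap_coords 1 3 p) \<and> f2 p = - f2 (swap_coords 2 3 p)" for p
  have Q: "AE p in torus_measure. Q p"
    using sym sum anti1 anti2 unfolding Q_def by eventually_elim blast
  note shift = measure_preserving_map_AE[OF measure_preserving_swap_coords]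
  note Q12 = shift[OF Q, of 1 2] and Q13 = shift[OF Q, of 1 3] and Q23 = shift[OF Q, of 2 3]
  have "AE p in torus_measure. f p + f (swap_coords 1 3 p) + f (swap_coords 2 3 p) = 0"
    using Q Q12 Q13 Q23 shift[OF Q13, of 1 2] shift[OF Q23, of 1 2]
  proof eventually_elim
    case (elim p)
    let ?c = "swap_coords 1 2 (swap_coords 2 3 p)" and ?d = "swap_coords 1 2 (swap_coords 1 3 p)"
    have Q_all: "Q p" "Q (swap_coords 1 2 p)" "Q (swap_coords 1 3 p)" "Q (swap_coords 2 3 p)"
      "Q ?c" "Q ?d"
      using elim by (simp_all add: swap_coords_conjugate)
    have "f1 p = - f1 (swap_coords 1 3 p)" "f1 (swap_coords 1 2 p) = - f1 ?c"
      "f1 (swap_coords 2 3 p) = - f1 ?d"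
      using Q_all by (auto simp: Q_def swap_coords_conjugate)
    moreover have "f2 p = - f2 (swap_coords 2 3 p)" "f2 (swap_coords 1 2 p) = - f2 ?d"
      "f2 (swap_coords 1 3 p) = - f2 ?c"
      using Q_all by (auto simp: Q_def swap_coords_conjugate)
    moreover have "f p = f (swap_coords 1 2 p)" "f (swap_coords 1 3 p) = f ?d"
      "f (swap_coords 2 3 p) = f ?c"
      using Q_all by (auto simp: Q_def)
    moreover have "f q = f1 q + f2 q" if "Q q" for q
      using that by (auto simp: Q_def)
    note this[OF Q_all(1)] this[OF Q_all(2)] this[OF Q_all(3)] this[OF Q_all(4)]
      this[OF Q_all(5)] this[OF Q_all(6)]
    \<comment> \<open>The left side is the sum of \<open>f\<close> over the orbit, by symmetry under
      exchange of the first two coordinates. In it the values of \<open>f1\<close> cancel in pairs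
      under (13), and those of \<open>f2\<close> under (23).\<close>
    ultimately have "2 * (f p + f (swap_coords 1 3 p) + f (swap_coords 2 3 p)) = 0"
      by algebra
    then show ?case by (metis mult_eq_0_iff zero_neq_numeral)
  qed
  moreover have "AE p in torus_measure. f (swap_coords 1 2 p) = f p"
    using sym by eventually_elim simp
  ultimately show "f \<in> ?R" using f by simp
next
  fix f assume "f \<in> ?R"
  then have f: "f \<in> L2e" and sym: "AE p in torus_measure. f (swap_coords 1 2 p) = f p"
    and sum: "AE p in torus_measure. f p + f (swap_coords 1 3 p) + f (swap_coords 2 3 p) = 0"
    by auto
  \<comment> \<open>\<open>h 1\<close> and \<open>h 2\<close> serve as \<open>f1\<close> and
    \<open>f2\<close>; their sum is \<open>f\<close> minus one third of the vanishing three-term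
    sum.\<close>
  define h where "h i p = (1/3) * (f p - f (swap_coords i 3 p))" for i p
  have h: "h i \<in> L2e" for i
    unfolding h_def by (intro L2e_cmult L2e_diff L2e_swap_coords f)
  have "AE p in torus_measure. f p = f (swap_coords 1 2 p)"
    using sym by eventually_elim simp
  moreover have "AE p in torus_measure. f p = h 1 p + h 2 p"
    using sum
  proof eventually_elim
    case (elim p)
    have "h 1 p + h 2 p = f p - (f p + f (swap_coords 1 3 p) + f (swap_coords 2 3 p)) / 3"
      by (simp add: h_def field_simps)
    with elim show ?case by simp
  qed
  moreover have "h i p = - h i (swap_coords i 3 p)" for i p
    by (simp add: h_def swap_coords_swap_coords field_simps)
  ultimately show "f \<in> L2e_mix"
    using f h unfolding L2e_mix_def by blast
qed

text \<open>The definition asks for some \<open>f1\<close> and \<open>f2\<close>, which need not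
  converge along a sequence. \<open>L2e_mix_eq\<close> replaces them by linear conditions on
  \<open>f\<close> alone.\<close>

lemma L2e_mix_closed: "L2_closed_subspace torus_measure L2e_mix"
proof -
  let ?A = "{f \<in> L2 torus_measure. AE p in torus_measure. f (swap_coords 1 2 p) = 1 * f p}"
  let ?xs = "[(1, \<lambda>p. p), (1, swap_coords 1 3), (1, swap_coords 2 3)]"
  let ?B = "{f \<in> L2 torus_measure. AE p in torus_measure. weighted_compose ?xs f p = 0}"
  have "L2_closed_subspace torus_measure ?A"
    by (rule L2_closed_subspace_AE_compose_eq[OF measure_preserving_swap_coords])
  moreover have "L2_closed_subspace torus_measure ?B"
    by (rule L2_closed_subspace_weighted_compose)
       (auto simp: measure_preserving_map_id measure_preserving_swap_coords)
  ultimately have "L2_closed_subspace torus_measure (\<Inter>{L2e, ?A, ?B})"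
    using L2e_closed by (intro L2_closed_subspace_Inter) auto
  also have "\<Inter>{L2e, ?A, ?B} = L2e_mix"
    using L2e_L2
    by (auto simp: L2e_mix_eq weighted_compose_Cons weighted_compose_Nil add.assoc)
  finally show ?thesis .
qed


section \<open>The decomposition\<close>

lemma L2e_s_swap_coords:
  assumes "f \<in> L2e_s"
  shows "AE p in torus_measure. f (swap_coords i j p) = f p"
  using assms permutes_swap_id[of i UNIV j] by (auto simp: L2e_s_def)

section \<open>Pairwise orthogonality\<close>

lemma L2e_s_orthogonal_a12: "L2_orthogonal torus_measure L2e_s L2e_a12"
  unfolding L2_orthogonal_def
proof (intro ballI)
  fix f g assume f: "f \<in> L2e_s" and g: "g \<in> L2e_a12"
  show "L2_inner torus_measure f g = 0"
  proof (rule L2_inner_eq_0_if_antisymmetric[OF measure_preserving_swap_coords[of 1 2]])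
    have "AE p in torus_measure. g p = - g (swap_coords 1 2 p)"
      using g by (simp add: L2e_a12_def)
    then show "AE p in torus_measure. f (swap_coords 1 2 p) * cnj (g (swap_coords 1 2 p))
        = - (f p * cnj (g p))"
      using L2e_s_swap_coords[OF f, of 1 2] by eventually_elim simp
  qed (use f g in \<open>auto simp: L2e_s_def L2e_a12_def L2e_L2\<close>)
qed

text \<open>The two summands of \<open>g\<close> are treated separately, each with the transposition
  that negates it and fixes \<open>f\<close>.\<close>

lemma L2e_s_orthogonal_mix: "L2_orthogonal torus_measure L2e_s L2e_mix"
  unfolding L2_orthogonal_def
proof (intro ballI)
  fix f g assume f: "f \<in> L2e_s" and g: "g \<in> L2e_mix"
  have f': "f \<in> L2 torus_measure" using f by (auto simp: L2e_s_def L2e_L2)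
  obtain g1 g2 where L: "g \<in> L2e" "g1 \<in> L2e" "g2 \<in> L2e"
    and sum: "AE p in torus_measure. g p = g1 p + g2 p"
    and anti: "AE p in torus_measure. g1 p = - g1 (swap_coords 1 3 p)"
      "AE p in torus_measure. g2 p = - g2 (swap_coords 2 3 p)"
    using g by (auto simp: L2e_mix_def)
  have 0: "L2_inner torus_measure f h = 0"
    if "h \<in> L2e" "AE p in torus_measure. h p = - h (swap_coords i j p)" for h i j
  proof (rule L2_inner_eq_0_if_antisymmetric[OF measure_preserving_swap_coords[of i j] f'])
    show "AE p in torus_measure. f (swap_coords i j p) * cnj (h (swap_coords i j p))
        = - (f p * cnj (h p))"
      using L2e_s_swap_coords[OF f, of i j] that(2) by eventually_elim simp
  qed (use that in \<open>simp add: L2e_L2\<close>)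
  have "L2_inner torus_measure f g = L2_inner torus_measure f (\<lambda>p. g1 p + g2 p)"
    using f' L sum by (intro L2_inner_cong) (auto simp: L2e_L2 L2e_add)
  also have "\<dots> = L2_inner torus_measure f g1 + L2_inner torus_measure f g2"
    using f' L by (intro L2_inner_add_right) (auto simp: L2e_L2)
  also have "\<dots> = 0"
    using 0 L anti by simp
  finally show "L2_inner torus_measure f g = 0" .
qed

lemma L2e_a12_orthogonal_mix: "L2_orthogonal torus_measure L2e_a12 L2e_mix"
  unfolding L2_orthogonal_def
proof (intro ballI)
  fix f g assume f: "f \<in> L2e_a12" and g: "g \<in> L2e_mix"
  show "L2_inner torus_measure f g = 0"
  proof (rule L2_inner_eq_0_if_antisymmetric[OF measure_preserving_swap_coords[of 1 2]])
    have "AE p in torus_measure. f p = - f (swap_coords 1 2 p)"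
      "AE p in torus_measure. g p = g (swap_coords 1 2 p)"
      using f g by (auto simp: L2e_a12_def L2e_mix_def)
    then show "AE p in torus_measure. f (swap_coords 1 2 p) * cnj (g (swap_coords 1 2 p))
        = - (f p * cnj (g p))"
      by eventually_elim simp
  qed (use f g in \<open>auto simp: L2e_mix_def L2e_a12_def L2e_L2\<close>)
qed

text \<open>Transpositions generate all permutations.\<close>

lemma permute_coords_invariant_if_swap_coords_invariant:
  assumes swap: "\<And>i j p. f (swap_coords i j p) = f p" and \<sigma>: "\<sigma> permutes UNIV"
  shows "f (permute_coords \<sigma> p) = f p"
proof -
  \<comment> \<open>Quantifying over \<open>p\<close> makes the induction hypothesis available at
    the swapped point.\<close>
  have "\<forall>p. f (permute_coords \<sigma> p) = f p"
    using \<sigma> finite[of UNIV]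
  proof (induction rule: permutes_induct)
    case id
    show ?case by (simp only: permute_coords_id simp_thms)
  next
    case (swap a b \<tau>)
    then show ?case
      by (metis assms(1) permute_coords_permute_coords)
  qed
  then show ?thesis by blast
qed

text \<open>For a fixed representative \<open>f\<close>, the permutation identities of the
  components and their sum hold at every point; only evenness is an almost everywhere
  statement.\<close>

lemma L2e_decomposition:
  assumes f: "f \<in> L2e"
  shows "\<exists>u\<in>L2e_s. \<exists>v\<in>L2e_a12. \<exists>w\<in>L2e_mix. AE p in torus_measure. f p = u p + v p + w p"
proof -
  define g where "g p = (1/2) * (f p + f (swap_coords 1 2 p))" for p
  define v where "v p = (1/2) * (f p - f (swap_coords 1 2 p))" for p
  \<comment> \<open>Three terms give the average over six permutations, since \<open>g\<close> takes
    equal values at points exchanged by (12).\<close>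
  define u where "u p = (1/3) * (g p + g (swap_coords 1 3 p) + g (swap_coords 2 3 p))" for p
  define w where "w p = g p - u p" for p
  have gL: "g \<in> L2e"
    unfolding g_def by (intro L2e_cmult L2e_add L2e_swap_coords f)
  have vL: "v \<in> L2e"
    unfolding v_def by (intro L2e_cmult L2e_diff L2e_swap_coords f)
  have uL: "u \<in> L2e"
    unfolding u_def by (intro L2e_cmult L2e_add L2e_swap_coords gL)
  have wL: "w \<in> L2e"
    unfolding w_def by (intro L2e_diff gL uL)
  have g: "g (swap_coords 1 2 p) = g p" for p
    by (simp add: g_def swap_coords_swap_coords add.commute)
  \<comment> \<open>Each transposition permutes the three summands of \<open>u\<close>, up to an
    outer (12) that \<open>g\<close> absorbs.\<close>
  have u12: "u (swap_coords 1 2 p) = u p" and u13: "u (swap_coords 1 3 p) = u p"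
    and u23: "u (swap_coords 2 3 p) = u p" for p
    by (simp_all add: u_def g swap_coords_conjugate swap_coords_swap_coords add_ac)
  have "u (swap_coords i j p) = u p" for i j p
    using exhaust_3[of i] exhaust_3[of j] u12[of p] u13[of p] u23[of p]
    by (auto simp: permute_coords_id transpose_commute[of 2 1] transpose_commute[of 3 1]
        transpose_commute[of 3 2])
  then have "u \<in> L2e_s"
    using uL permute_coords_invariant_if_swap_coords_invariant[of u] by (simp add: L2e_s_def)
  moreover have "v \<in> L2e_a12"
    using vL by (simp add: L2e_a12_def v_def swap_coords_swap_coords field_simps)
  moreover have "w \<in> L2e_mix"
  proof -
    \<comment> \<open>Both swaps fix \<open>u\<close>, so the \<open>u\<close> parts contribute -3
      \<open>u p\<close>, which cancels the three values of \<open>g\<close>.\<close>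
    have "w p + w (swap_coords 1 3 p) + w (swap_coords 2 3 p) = 0" for p
      by (simp add: w_def u13 u23) (simp add: u_def)
    then show ?thesis using wL by (simp add: L2e_mix_eq w_def g u12)
  qed
  moreover have "f p = u p + v p + w p" for p
    by (simp add: w_def g_def v_def field_simps)
  ultimately show ?thesis by blast
qed

theorem theorem3p1:
  shows "L2_orthogonal_sum3 torus_measure L2e L2e_s L2e_a12 L2e_mix"
proof (rule L2_orthogonal_sum3I)
  show "L2e_s \<subseteq> L2e" "L2e_a12 \<subseteq> L2e" "L2e_mix \<subseteq> L2e"
    by (auto simp: L2e_s_def L2e_a12_def L2e_mix_def)
qed (fact L2e_closed L2e_s_closed L2e_a12_closed L2e_mix_closed L2e_s_orthogonal_a12
    L2e_s_orthogonal_mix L2e_a12_orthogonal_mix L2e_decomposition)+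

end
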